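(* Let $W$ be the finite reflection group of type $B_n$ or $D_n$ acting on $\mathbb{R}^n$, with root system $\Phi$. Suppose $\mathcal{S}\subseteq W$ has size $n+1$. Define $$T:=\{\{i,j\} : vw^{-1}=s_\alpha \text{ with } \alpha=e_i-e_j, \text{ for some } v,w\in\mathcal{S}\}$$ and consider $T$ as (the edge set of) a graph on the vertex set $[n]=\{1,\dots,n\}$. If $T$ is connected and there exist $v,w\in\mathcal{S}$ such that $vw^{-1}=s_\beta$ for some $\beta\in\Phi$ which is not a type A root, then $\mathcal{S}$ is a persistent simplex.
   Context: Standard realizations: type $B_n$ has roots $\pm e_i$ ($1\le i\le n$) and $\pm e_i\pm e_j$ ($i<j$); type $D_n$ has roots $\pm e_i\pm e_j$ ($i<j$) (with the usual ranges $n\ge2$ for $B_n$, $n\ge4$ for $D_n$). $W$ is generated by the orthogonal reflections $s_\alpha$ in the hyperplanes $\alpha^\perp$, $\alpha\in\Phi$. The type A roots are $\{e_i-e_j\}_{i\neq j}\subset\Phi$. $B$ is a fixed open fundamental chamber of $W$, i.e. a connected component of the complement of the hyperplanes $\alpha^\perp$, $\alpha\in\Phi$. For $\mathbf{a}\in B$, $\mathrm{conv}(W\cdot\mathbf{a})$ has dimension $n$. A subset $\mathcal{S}\subseteq W$ of size $n+1$ is a persistent simplex if $\mathrm{conv}(\mathcal{S}\cdot\mathbf{a})$ is an $n$-dimensional simplex for every $\mathbf{a}\in B$. *)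

theory Defs
  imports "HOL-Analysis.Analysis" "HOL-Algebra.Bij" "HOL-Algebra.Generated_Groups"
begin

definition roots_A :: "(real ^ 'n) set" where
  "roots_A = {axis i 1 - axis j 1 | i j. i \<noteq> j}"

text \<open>The root sets do not depend on an ordering of the coordinates, so the index condition
  \<open>i < j\<close> may be replaced by \<open>i \<noteq> j\<close>. The rank restrictions (\<open>n \<ge> 2\<close>, respectively \<open>n \<ge> 4\<close>)
  are imposed where the root systems are used.\<close>

definition roots_D :: "(real ^ 'n) set" where
  "roots_D = {a *\<^sub>R axis i 1 + b *\<^sub>R axis j 1 | a b i j. a \<in> {1, -1} \<and> b \<in> {1, -1} \<and> i \<noteq> j}"

definition roots_B :: "(real ^ 'n) set" where
  "roots_B = {a *\<^sub>R axis i 1 | a i. a \<in> {1, -1}} \<union> roots_D"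

definition reflection :: "'a::real_inner \<Rightarrow> 'a \<Rightarrow> 'a" where
  "reflection \<alpha> x = x - (2 * (x \<bullet> \<alpha>) / (\<alpha> \<bullet> \<alpha>)) *\<^sub>R \<alpha>"

text \<open>The reflection group is generated inside the group of all bijections of the space, whose
  multiplication is composition of functions (the right factor acts first).\<close>

definition reflection_group :: "'a::real_inner set \<Rightarrow> ('a \<Rightarrow> 'a) set" where
  "reflection_group \<Phi> = generate (BijGroup UNIV) (reflection ` \<Phi>)"

definition chambers :: "'a::real_inner set \<Rightarrow> 'a set set" where
  "chambers \<Phi> = components (UNIV - (\<Union>\<alpha>\<in>\<Phi>. {x. \<alpha> \<bullet> x = 0}))"

definition group_quotient :: "('a \<Rightarrow> 'a) \<Rightarrow> ('a \<Rightarrow> 'a) \<Rightarrow> ('a \<Rightarrow> 'a)" where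
  "group_quotient v w = v \<otimes>\<^bsub>BijGroup UNIV\<^esub> inv\<^bsub>BijGroup UNIV\<^esub> w"

definition persistent_simplex ::
    "'a::euclidean_space set \<Rightarrow> 'a set \<Rightarrow> ('a \<Rightarrow> 'a) set \<Rightarrow> bool" where
  "persistent_simplex \<Phi> B S \<longleftrightarrow>
     S \<subseteq> reflection_group \<Phi> \<and> card S = DIM('a) + 1 \<and>
     (\<forall>a\<in>B. int DIM('a) simplex (convex hull ((\<lambda>w. w a) ` S)))"

definition type_A_graph :: "(real ^ 'n \<Rightarrow> real ^ 'n) set \<Rightarrow> 'n set set" where
  "type_A_graph S =
     {{i, j} | i j. i \<noteq> j \<and> (\<exists>v\<in>S. \<exists>w\<in>S. group_quotient v w = reflection (axis i 1 - axis j 1))}"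

definition connected_graph :: "'v set \<Rightarrow> 'v set set \<Rightarrow> bool" where
  "connected_graph V E \<longleftrightarrow>
     V \<noteq> {} \<and> (\<forall>x\<in>V. \<forall>y\<in>V. (x, y) \<in> {(u, v). u \<in> V \<and> v \<in> V \<and> {u, v} \<in> E}\<^sup>*)"

end

theory Submission
  imports Defs
begin

text \<open>
  Fix \<open>a \<in> B\<close> and let \<open>U\<close> be the direction space of the affine hull of the points \<open>w a\<close> with
  \<open>w \<in> S\<close>. If \<open>v w\<^sup>-\<^sup>1\<close> is the reflection in a root \<open>\<alpha>\<close>, then \<open>v a - w a\<close> is a scalar
  multiple of \<open>\<alpha>\<close>, and the scalar vanishes only if \<open>w a\<close> lies on the hyperplane orthogonal to \<open>\<alpha>\<close>.
  That cannot happen, because \<open>a\<close> lies off all root hyperplanes and the group permutes these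
  hyperplanes (\<open>reflection_group_regular\<close>). Hence \<open>\<alpha> \<in> U\<close> (\<open>root_in_direction_space\<close>).

  Thus every edge \<open>{i, j}\<close> of the graph puts \<open>e\<^sub>i - e\<^sub>j\<close> into \<open>U\<close>, and connectedness puts there
  all vectors whose coordinates sum to zero. A root that is not of type A has nonzero coordinate
  sum, so \<open>U\<close> is the whole space (\<open>subspace_eq_UNIV\<close>). At most \<open>n + 1\<close> points whose affine hull has
  dimension \<open>n\<close> are the vertices of an \<open>n\<close>-simplex.
\<close>

section \<open>Regular points are preserved by the reflection group\<close>

lemma roots_D_subset_roots_B: "roots_D \<subseteq> roots_B"
  by (auto simp: roots_B_def)

text \<open>Every reflection of type \<open>B\<close> is a signed permutation of the coordinates, so it permutes their
  absolute values. Being regular is a condition on these absolute values alone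
  (\<open>regular_D_iff\<close> and \<open>regular_B_iff\<close>), which makes it invariant under the group.\<close>

lemma abs_reflection_permutes:
  fixes \<beta> :: "real ^ 'n"
  assumes "\<beta> \<in> roots_B"
  obtains p where "inj p" "\<And>x k. \<bar>reflection \<beta> x $ k\<bar> = \<bar>x $ p k\<bar>"
proof -
  from assms consider
      (short) a i where "a \<in> {1, -1 :: real}" "\<beta> = a *\<^sub>R axis i 1"
    | (long) a b i j where "a \<in> {1, -1 :: real}" "b \<in> {1, -1 :: real}" "i \<noteq> j"
        "\<beta> = a *\<^sub>R axis i 1 + b *\<^sub>R axis j 1"
    unfolding roots_B_def roots_D_def by blast
  then show ?thesis
  proof cases
    case short
    have "\<bar>reflection \<beta> x $ k\<bar> = \<bar>x $ id k\<bar>" for x k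
      using short by (auto simp: reflection_def inner_axis) (auto simp: axis_def)
    then show ?thesis by (intro that[of id]) auto
  next
    case long
    have sq: "a * a = 1" "b * b = 1" using long by auto
    have nn: "\<beta> \<bullet> \<beta> = 2"
      using long(3) sq by (simp add: long(4) inner_axis inner_add_right) (simp add: axis_def)
    have xb: "x \<bullet> \<beta> = a * x $ i + b * x $ j" for x
      by (simp add: long(4) inner_axis inner_add_right)
    have "reflection \<beta> x = x - (a * x $ i + b * x $ j) *\<^sub>R \<beta>" for x
      unfolding reflection_def nn by (simp add: xb)
    then have "\<bar>reflection \<beta> x $ k\<bar> = \<bar>x $ Transposition.transpose i j k\<bar>" for x k
      using long(1-3)
      by (auto simp: long(4) axis_def Transposition.transpose_def)
    then show ?thesis by (intro that[of "Transposition.transpose i j"]) auto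
  qed
qed

definition regular :: "'a::real_inner set \<Rightarrow> 'a \<Rightarrow> bool" where
  "regular \<Phi> x \<longleftrightarrow> (\<forall>\<alpha>\<in>\<Phi>. \<alpha> \<bullet> x \<noteq> 0)"

lemma regular_D_iff: "regular roots_D x \<longleftrightarrow> inj (\<lambda>i. \<bar>x $ i\<bar>)"
  for x :: "real ^ 'n"
proof -
  have "regular roots_D x \<longleftrightarrow> (\<forall>i j. i \<noteq> j \<longrightarrow> x $ i \<noteq> x $ j \<and> x $ i \<noteq> - x $ j)"
  proof (intro iffI allI impI)
    fix i j :: 'n assume reg: "regular roots_D x" and "i \<noteq> j"
    have "(1 *\<^sub>R axis i 1 + b *\<^sub>R axis j 1) \<bullet> x \<noteq> 0" if "b \<in> {1, -1}" for b :: real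
      using reg that \<open>i \<noteq> j\<close> unfolding regular_def roots_D_def by blast
    from this[of 1] this[of "-1"] show "x $ i \<noteq> x $ j \<and> x $ i \<noteq> - x $ j"
      by (auto simp: inner_add_left inner_diff_left inner_axis')
  next
    assume "\<forall>i j. i \<noteq> j \<longrightarrow> x $ i \<noteq> x $ j \<and> x $ i \<noteq> - x $ j"
    then show "regular roots_D x"
      by (auto simp: regular_def roots_D_def inner_add_left inner_diff_left inner_axis'
          add_eq_0_iff) metis
  qed
  also have "\<dots> \<longleftrightarrow> (\<forall>i j. i \<noteq> j \<longrightarrow> \<bar>x $ i\<bar> \<noteq> \<bar>x $ j\<bar>)"
    by (simp add: abs_eq_iff)
  finally show ?thesis unfolding inj_def by blast
qed

lemma regular_B_iff:
  "regular roots_B x \<longleftrightarrow> inj (\<lambda>i. \<bar>x $ i\<bar>) \<and> (\<forall>i. \<bar>x $ i\<bar> \<noteq> 0)"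
  for x :: "real ^ 'n"
proof -
  have "regular roots_B x \<longleftrightarrow> regular roots_D x \<and> (\<forall>i. x $ i \<noteq> 0)"
    unfolding regular_def roots_B_def by (force simp: inner_axis')
  then show ?thesis by (simp add: regular_D_iff)
qed

lemma regular_reflection:
  fixes x :: "real ^ 'n"
  assumes "\<Phi> = roots_B \<or> \<Phi> = roots_D" "\<beta> \<in> \<Phi>" "regular \<Phi> x"
  shows "regular \<Phi> (reflection \<beta> x)"
proof -
  obtain p where p: "inj p" "\<And>x k. \<bar>reflection \<beta> x $ k\<bar> = \<bar>x $ p k\<bar>"
    using abs_reflection_permutes assms roots_D_subset_roots_B by blast
  have "inj (\<lambda>i. \<bar>x $ p i\<bar>)" if "inj (\<lambda>i. \<bar>x $ i\<bar>)"
    using inj_compose[OF that p(1)] by (simp add: comp_def)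
  then show ?thesis
    using assms(1,3) by (auto simp: regular_B_iff regular_D_iff p(2))
qed

lemma reflection_involution [simp]: "reflection \<alpha> (reflection \<alpha> x) = x"
  by (cases "\<alpha> = 0") (simp_all add: reflection_def inner_diff_left)

lemma reflection_in_BijGroup: "reflection \<alpha> \<in> carrier (BijGroup UNIV)"
  by (auto simp: BijGroup_def Bij_def intro!: o_bij[of "reflection \<alpha>"])

lemma BijGroup_mult_apply:
  assumes "f \<in> carrier (BijGroup UNIV)" "g \<in> carrier (BijGroup UNIV)"
  shows "(f \<otimes>\<^bsub>BijGroup UNIV\<^esub> g) x = f (g x)"
  using assms by (simp add: BijGroup_def compose_def)

lemma inv_reflection: "inv\<^bsub>BijGroup UNIV\<^esub> (reflection \<alpha>) = reflection \<alpha>"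
proof (rule group.inv_equality[OF group_BijGroup])
  show "reflection \<alpha> \<otimes>\<^bsub>BijGroup UNIV\<^esub> reflection \<alpha> = \<one>\<^bsub>BijGroup UNIV\<^esub>"
    by (rule ext) (simp add: BijGroup_mult_apply reflection_in_BijGroup, simp add: BijGroup_def)
qed (rule reflection_in_BijGroup)+

lemma reflection_group_in_BijGroup:
  "w \<in> reflection_group \<Phi> \<Longrightarrow> w \<in> carrier (BijGroup UNIV)"
  unfolding reflection_group_def
  by (rule group.generate_in_carrier[OF group_BijGroup]) (auto intro: reflection_in_BijGroup)

lemma reflection_group_regular:
  fixes x :: "real ^ 'n"
  assumes "\<Phi> = roots_B \<or> \<Phi> = roots_D" "w \<in> reflection_group \<Phi>" "regular \<Phi> x"
  shows "regular \<Phi> (w x)"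
  using assms(2,3) unfolding reflection_group_def
proof (induction arbitrary: x rule: generate.induct)
  case one
  then show ?case by (simp add: BijGroup_def)
next
  case (incl h)
  then show ?case using regular_reflection[OF assms(1)] by auto
next
  case (inv h)
  then show ?case using regular_reflection[OF assms(1)] by (auto simp: inv_reflection)
next
  case (eng h g)
  then have "h \<in> carrier (BijGroup UNIV)" "g \<in> carrier (BijGroup UNIV)"
    using reflection_group_in_BijGroup unfolding reflection_group_def by blast+
  with eng show ?case by (simp add: BijGroup_mult_apply)
qed

section \<open>Roots as directions between orbit points\<close>

lemma group_quotient_eq_reflection:
  assumes "v \<in> carrier (BijGroup UNIV)" "w \<in> carrier (BijGroup UNIV)"
    and "group_quotient v w = reflection \<alpha>"
  shows "v x = reflection \<alpha> (w x)"
proof -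
  interpret group "BijGroup (UNIV :: 'a set)" by (rule group_BijGroup)
  have "v = reflection \<alpha> \<otimes>\<^bsub>BijGroup UNIV\<^esub> w"
    using assms unfolding group_quotient_def by (metis inv_solve_right reflection_in_BijGroup)
  then show ?thesis by (simp add: BijGroup_mult_apply reflection_in_BijGroup assms(2))
qed

text \<open>The scalar in \<open>reflection \<alpha> y - y = c \<alpha>\<close> is nonzero as soon as \<open>y\<close> is off the hyperplane
  orthogonal to \<open>\<alpha>\<close>, so it can be divided out.\<close>

lemma root_in_direction_space:
  fixes U :: "'a::euclidean_space set"
  assumes "subspace U" "reflection \<alpha> y - y \<in> U" "\<alpha> \<bullet> y \<noteq> 0"
  shows "\<alpha> \<in> U"
proof -
  define c where "c = - (2 * (y \<bullet> \<alpha>) / (\<alpha> \<bullet> \<alpha>))"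
  have "c \<noteq> 0" using assms(3) by (auto simp: c_def inner_commute)
  have "reflection \<alpha> y - y = c *\<^sub>R \<alpha>" by (simp add: c_def reflection_def)
  then have "(1 / c) *\<^sub>R (c *\<^sub>R \<alpha>) \<in> U" using assms(1,2) by (metis subspace_scale)
  with \<open>c \<noteq> 0\<close> show ?thesis by simp
qed

section \<open>Spanning the whole space\<close>

lemma non_type_A_root_sum:
  fixes \<beta> :: "real ^ 'n"
  assumes "\<beta> \<in> roots_B - roots_A"
  shows "(\<Sum>k\<in>UNIV. \<beta> $ k) \<noteq> 0"
proof -
  have sum_axis: "(\<Sum>k\<in>UNIV. (axis i 1 :: real ^ 'n) $ k) = 1" for i
    by (simp add: axis_def)
  from assms consider
      (short) a i where "a \<in> {1, -1 :: real}" "\<beta> = a *\<^sub>R axis i 1"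
    | (long) a b i j where "a \<in> {1, -1 :: real}" "b \<in> {1, -1 :: real}" "i \<noteq> j"
        "\<beta> = a *\<^sub>R axis i 1 + b *\<^sub>R axis j 1"
    unfolding roots_B_def roots_D_def by blast
  then show ?thesis
  proof cases
    case short
    then show ?thesis by (simp flip: sum_distrib_left add: sum_axis) auto
  next
    case long
    \<comment> \<open>Opposite signs would make \<open>\<beta>\<close> a difference of two unit vectors, of type A.\<close>
    have "axis i 1 - axis j 1 \<in> (roots_A :: (real ^ 'n) set)"
      "axis j 1 - axis i 1 \<in> (roots_A :: (real ^ 'n) set)"
      using long(3) unfolding roots_A_def by blast+
    then have "a + b \<noteq> 0" using assms long by auto
    then show ?thesis
      by (simp add: long(4) sum.distrib sum_axis flip: sum_distrib_left)
  qed
qed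

text \<open>The differences of unit vectors span the hyperplane of vectors with coordinate sum zero, and
  \<open>\<beta>\<close> is off this hyperplane. Concretely, subtracting \<open>\<Sum>k. \<beta>\<^sub>k (e\<^sub>k - e\<^sub>i)\<close> from \<open>\<beta>\<close> leaves the
  multiple \<open>(\<Sum>k. \<beta>\<^sub>k) e\<^sub>i\<close> of a unit vector.\<close>

lemma subspace_eq_UNIV:
  fixes U :: "(real ^ 'n) set"
  assumes U: "subspace U" and diff: "\<And>i j. axis i 1 - axis j 1 \<in> U"
    and \<beta>: "\<beta> \<in> U" "(\<Sum>k\<in>UNIV. \<beta> $ k) \<noteq> 0"
  shows "U = UNIV"
proof -
  have expand: "x = (\<Sum>k\<in>UNIV. x $ k *\<^sub>R axis k 1)" for x :: "real ^ 'n"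
    using basis_expansion[of x] by (simp add: scalar_mult_eq_scaleR)
  have unit: "axis i 1 \<in> U" for i
  proof -
    let ?s = "\<Sum>k\<in>UNIV. \<beta> $ k"
    have "\<beta> - (\<Sum>k\<in>UNIV. \<beta> $ k *\<^sub>R (axis k 1 - axis i 1)) \<in> U"
      by (intro subspace_diff[OF U \<beta>(1)] subspace_sum[OF U] subspace_scale[OF U] diff)
    also have "\<beta> - (\<Sum>k\<in>UNIV. \<beta> $ k *\<^sub>R (axis k 1 - axis i 1)) = ?s *\<^sub>R axis i 1"
      using expand[of \<beta>] by (simp add: scaleR_diff_right sum_subtractf scaleR_left.sum)
    finally have "(1 / ?s) *\<^sub>R (?s *\<^sub>R axis i 1) \<in> U" using U by (metis subspace_scale)
    with \<beta>(2) show ?thesis by simp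
  qed
  have "x \<in> U" for x
    by (subst expand) (intro subspace_sum subspace_scale U unit)
  then show ?thesis by auto
qed

text \<open>A path between two vertices telescopes the corresponding differences of unit vectors.\<close>

lemma connected_graph_differences:
  fixes U :: "(real ^ 'n) set"
  assumes conn: "connected_graph UNIV E" and U: "subspace U"
    and edge: "\<And>i j. {i, j} \<in> E \<Longrightarrow> axis i 1 - axis j 1 \<in> U"
  shows "axis i 1 - axis j 1 \<in> U"
proof -
  have "(i, j) \<in> {(u, v). u \<in> UNIV \<and> v \<in> UNIV \<and> {u, v} \<in> E}\<^sup>*"
    using conn unfolding connected_graph_def by blast
  then show ?thesis
  proof induction
    case base
    then show ?case using U by (simp add: subspace_0)
  next
    case (step y z)
    then have "(axis i 1 - axis y 1) + (axis y 1 - axis z 1) \<in> U"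
      using U edge by (intro subspace_add) auto
    then show ?case by simp
  qed
qed

section \<open>The simplex\<close>

lemma simplex_if_full_aff_dim:
  fixes P :: "'a::euclidean_space set"
  assumes "finite P" "card P \<le> DIM('a) + 1" "aff_dim P = int DIM('a)"
  shows "int DIM('a) simplex (convex hull P)"
proof -
  have "card P = DIM('a) + 1" using assms aff_dim_le_card[of P] by simp
  moreover from this have "\<not> affine_dependent P"
    using assms by (simp add: affine_independent_iff_card)
  ultimately show ?thesis using \<open>finite P\<close> unfolding simplex by (intro exI[of _ P]) simp
qed

theorem proposition5p4:
  fixes \<Phi> :: "(real ^ 'n) set"
    and B :: "(real ^ 'n) set"
    and S :: "(real ^ 'n \<Rightarrow> real ^ 'n) set"
  assumes type_B_or_D: "(\<Phi> = roots_B \<and> CARD('n) \<ge> 2) \<or> (\<Phi> = roots_D \<and> CARD('n) \<ge> 4)"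
    and chamber: "B \<in> chambers \<Phi>"
    and subset_W: "S \<subseteq> reflection_group \<Phi>"
    and size: "card S = CARD('n) + 1"
    and connected_T: "connected_graph UNIV (type_A_graph S)"
    and non_type_A: "\<exists>v\<in>S. \<exists>w\<in>S. \<exists>\<beta>\<in>\<Phi> - roots_A. group_quotient v w = reflection \<beta>"
  shows "persistent_simplex \<Phi> B S"
  unfolding persistent_simplex_def
proof (intro conjI ballI)
  show "S \<subseteq> reflection_group \<Phi>" by (rule subset_W)
  show "card S = DIM(real ^ 'n) + 1" using size by simp
next
  fix a assume "a \<in> B"
  have \<Phi>: "\<Phi> = roots_B \<or> \<Phi> = roots_D" using type_B_or_D by blast
  then have \<Phi>_sub: "roots_D \<subseteq> \<Phi>" "\<Phi> \<subseteq> roots_B" using roots_D_subset_roots_B by blast+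
  have "regular \<Phi> a"
    using in_components_subset[OF chamber[unfolded chambers_def]] \<open>a \<in> B\<close>
    by (auto simp: regular_def)
  define P where "P = (\<lambda>w. w a) ` S"
  have "finite S" using size by (intro card_ge_0_finite) simp
  obtain w0 where "w0 \<in> S" using size by fastforce
  define U where "U = span ((\<lambda>x. - w0 a + x) ` P)"
  have U: "subspace U" by (simp add: U_def)
  have diff_U: "v a - w a \<in> U" if "v \<in> S" "w \<in> S" for v w
  proof -
    have "(- w0 a + v a) - (- w0 a + w a) \<in> U"
      unfolding U_def P_def using that by (intro span_diff span_base) auto
    then show ?thesis by simp
  qed
  have root_U: "\<alpha> \<in> U"
    if "v \<in> S" "w \<in> S" "\<alpha> \<in> \<Phi>" "group_quotient v w = reflection \<alpha>" for v w \<alpha>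
  proof (rule root_in_direction_space[OF U])
    have "v \<in> carrier (BijGroup UNIV)" "w \<in> carrier (BijGroup UNIV)"
      using that(1,2) subset_W by (auto intro: reflection_group_in_BijGroup)
    then have "v a = reflection \<alpha> (w a)"
      using that(4) by (rule group_quotient_eq_reflection)
    then show "reflection \<alpha> (w a) - w a \<in> U" using diff_U[OF that(1,2)] by simp
    have "regular \<Phi> (w a)"
      using reflection_group_regular[OF \<Phi> _ \<open>regular \<Phi> a\<close>] that subset_W by blast
    then show "\<alpha> \<bullet> w a \<noteq> 0" using that by (simp add: regular_def)
  qed
  have type_A_in_\<Phi>: "axis i 1 - axis j 1 \<in> \<Phi>" if "i \<noteq> j" for i j
  proof -
    have "(1 :: real) *\<^sub>R axis i 1 + (-1) *\<^sub>R axis j 1 \<in> (roots_D :: (real ^ 'n) set)"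
      unfolding roots_D_def using that by blast
    then show ?thesis using \<Phi>_sub by auto
  qed
  have edge_U: "axis i 1 - axis j 1 \<in> U" if ij: "{i, j} \<in> type_A_graph S" for i j
  proof -
    \<comment> \<open>An edge determines its root only up to sign, since its endpoints are unordered.\<close>
    obtain i' j' v w where e: "{i, j} = {i', j'}" "i' \<noteq> j'" "v \<in> S" "w \<in> S"
      "group_quotient v w = reflection (axis i' 1 - axis j' 1)"
      using ij unfolding type_A_graph_def by blast
    have "axis i' 1 - axis j' 1 \<in> U" using root_U e type_A_in_\<Phi> by blast
    moreover from this have "axis j' 1 - axis i' 1 \<in> U" using subspace_neg[OF U] by fastforce
    ultimately show ?thesis using e(1) by (auto simp: doubleton_eq_iff)
  qed
  obtain \<beta> where "\<beta> \<in> \<Phi> - roots_A" "\<beta> \<in> U" using non_type_A root_U by blast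
  then have "U = UNIV"
    using U connected_graph_differences[OF connected_T U edge_U] non_type_A_root_sum \<Phi>_sub(2)
    by (intro subspace_eq_UNIV) auto
  have "aff_dim P = int (dim ((\<lambda>x. - w0 a + x) ` P))"
    using \<open>w0 \<in> S\<close> by (intro aff_dim_eq_dim hull_inc) (simp add: P_def)
  also have "\<dots> = int DIM(real ^ 'n)"
    using \<open>U = UNIV\<close> unfolding U_def by (metis dim_span dim_UNIV)
  finally show "int DIM(real ^ 'n) simplex (convex hull ((\<lambda>w. w a) ` S))"
    using \<open>finite S\<close> size card_image_le[of S "\<lambda>w. w a"]
    by (fold P_def) (intro simplex_if_full_aff_dim, simp_all add: P_def)
qed

end
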